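(* Let $a_3,a_6\in\mathbb{Z}$ be such that $E: y^2+a_3y=x^3+a_6$ is an elliptic curve over $\mathbb{Q}$, and let $z=-x/y$. Then the $z$-power series expansion of the invariant differential of $E$ is \[\omega_E=\sum_{n=1}^{\infty}\left(\sum_{k=\lfloor (n-1)/2\rfloor}^{n-1}\binom{n+k-1}{k}\binom{k}{n-k-1}a_3^{2k-n+1}a_6^{n-k-1}\right)z^{3n-3}\,dz.\]
   Context: With $z=-x/y$ and $w=-1/y$ the equation becomes $w=z^3+a_3w^2+a_6w^3$, which has a unique power series solution $w(z)=z^3+O(z^4)$; then $x=z/w(z)$, $y=-1/w(z)$, and the invariant differential $\omega_E=\frac{dy}{3x^2}=\frac{dx}{2y+a_3}$ is expanded as a power series in $z$ times $dz$. Binomial coefficients $\binom{c}{j}$ with $c\ge0$ vanish for $j<0$ or $j>c$, and a summand whose binomial coefficient vanishes is interpreted as $0$ (even if the exponent of $a_3$ is negative). *)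

theory Defs
  imports
    "HOL-Computational_Algebra.Formal_Laurent_Series"
    "HOL-Algebra.Algebraic_Closure_Type"
begin

text \<open>The homogeneous equation of \<open>y\<^sup>2 + a\<^sub>3 y = x\<^sup>3 + a\<^sub>6\<close>, over an arbitrary commutative ring so
  that it can be evaluated at field elements as well as at polynomials.\<close>

definition weierstrass_form :: "int \<Rightarrow> int \<Rightarrow> 'a::comm_ring_1 \<Rightarrow> 'a \<Rightarrow> 'a \<Rightarrow> 'a" where
  "weierstrass_form a3 a6 x y z = y\<^sup>2 * z + of_int a3 * y * z\<^sup>2 - x ^ 3 - of_int a6 * z ^ 3"

definition singular_point :: "int \<Rightarrow> int \<Rightarrow> 'a::field \<Rightarrow> 'a \<Rightarrow> 'a \<Rightarrow> bool" where
  "singular_point a3 a6 x y z \<longleftrightarrow>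
     weierstrass_form a3 a6 x y z = 0 \<and>
     poly (pderiv (weierstrass_form a3 a6 [:0, 1:] [:y:] [:z:])) x = 0 \<and>
     poly (pderiv (weierstrass_form a3 a6 [:x:] [:0, 1:] [:z:])) y = 0 \<and>
     poly (pderiv (weierstrass_form a3 a6 [:x:] [:y:] [:0, 1:])) z = 0"

text \<open>A Weierstrass cubic with rational coefficients is an elliptic curve over the rationals iff
  it has no singular projective point over an algebraic closure; the base point is \<open>[0 : 1 : 0]\<close>.\<close>

definition is_elliptic_curve :: "int \<Rightarrow> int \<Rightarrow> bool" where
  "is_elliptic_curve a3 a6 \<longleftrightarrow>
     (\<forall>x y z :: rat alg_closure. (x, y, z) \<noteq> (0, 0, 0) \<longrightarrow> \<not> singular_point a3 a6 x y z)"

definition is_w_expansion :: "int \<Rightarrow> int \<Rightarrow> rat fps \<Rightarrow> bool" where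
  "is_w_expansion a3 a6 w \<longleftrightarrow>
     w = fps_X ^ 3 + of_int a3 * w\<^sup>2 + of_int a6 * w ^ 3 \<and>
     (\<forall>i<3. fps_nth w i = 0) \<and> fps_nth w 3 = 1"

definition w_expansion :: "int \<Rightarrow> int \<Rightarrow> rat fps" where
  "w_expansion a3 a6 = (THE w. is_w_expansion a3 a6 w)"

definition x_expansion :: "int \<Rightarrow> int \<Rightarrow> rat fls" where
  "x_expansion a3 a6 = fls_X / fps_to_fls (w_expansion a3 a6)"

definition y_expansion :: "int \<Rightarrow> int \<Rightarrow> rat fls" where
  "y_expansion a3 a6 = - 1 / fps_to_fls (w_expansion a3 a6)"

text \<open>A differential \<open>f dz\<close> is represented by the Laurent series \<open>f\<close> in \<open>z\<close>; in particular \<open>dx\<close> is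
  represented by the formal derivative of the expansion of \<open>x\<close>.  This is \<open>dx / (2 y + a\<^sub>3)\<close>; the
  agreement with \<open>dy / (3 x\<^sup>2)\<close> is \<open>invariant_differential_alt\<close> below.\<close>

definition invariant_differential :: "int \<Rightarrow> int \<Rightarrow> rat fls" where
  "invariant_differential a3 a6 =
     fls_deriv (x_expansion a3 a6) / (2 * y_expansion a3 a6 + of_int a3)"

lemma ex1_w_expansion: "\<exists>!w. is_w_expansion a3 a6 w"
proof (rule ex_ex1I)
  define G :: "rat fps" where "G = fps_X - of_int a3 * fps_X\<^sup>2 - of_int a6 * fps_X ^ 3"
  have G: "fps_nth G 0 = 0" "fps_nth G 1 \<noteq> 0"
    by (simp_all add: G_def power2_eq_square power3_eq_cube flip: fps_of_int)
  define V where "V = fps_inv G"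
  have V0: "fps_nth V 0 = 0" by (simp add: V_def fps_inv_def)
  have V1: "fps_nth V 1 = 1"
    by (simp add: V_def fps_inv_def G_def power2_eq_square power3_eq_cube flip: fps_of_int)
  have "G oo V = fps_X" unfolding V_def by (rule fps_inv_right[OF G])
  hence V: "V - of_int a3 * V\<^sup>2 - of_int a6 * V ^ 3 = fps_X"
    using V0 by (simp add: G_def fps_compose_sub_distrib fps_compose_mult_distrib
        flip: fps_of_int fps_compose_power)
  define w where "w = V oo (fps_X ^ 3)"
  have X0: "fps_nth (fps_X ^ 3 :: rat fps) 0 = 0" by simp
  have "w - of_int a3 * w\<^sup>2 - of_int a6 * w ^ 3 = fps_X ^ 3"
    using arg_cong[OF V, of "\<lambda>f. f oo (fps_X ^ 3)"] X0
    by (simp add: w_def fps_compose_sub_distrib fps_compose_mult_distrib fps_compose_power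
        flip: fps_of_int)
  moreover have w_nth: "fps_nth w n = (\<Sum>i=0..n. fps_nth V i * (if 3 * i = n then 1 else 0))" for n
    unfolding w_def fps_compose_nth by (intro sum.cong) (auto simp flip: power_mult)
  moreover have "fps_nth w i = 0" if "i < 3" for i
    unfolding w_nth using that V0 by (intro sum.neutral) (auto intro: gr0I)
  moreover have "fps_nth w 3 = 1"
    unfolding w_nth using V1 by (simp add: numeral_3_eq_3)
  ultimately show "\<exists>w. is_w_expansion a3 a6 w"
    unfolding is_w_expansion_def by (intro exI[of _ w]) (auto simp: algebra_simps)
next
  fix w v assume w: "is_w_expansion a3 a6 w" and v: "is_w_expansion a3 a6 v"
  define c :: "rat fps" where
    "c = 1 - of_int a3 * (w + v) - of_int a6 * (w\<^sup>2 + w * v + v\<^sup>2)"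
  have "(w - v) * c = (w - of_int a3 * w\<^sup>2 - of_int a6 * w ^ 3)
      - (v - of_int a3 * v\<^sup>2 - of_int a6 * v ^ 3)"
    by (simp add: c_def algebra_simps power2_eq_square power3_eq_cube)
  also have "w - of_int a3 * w\<^sup>2 - of_int a6 * w ^ 3 = fps_X ^ 3"
    using w unfolding is_w_expansion_def by (simp add: algebra_simps)
  also have "v - of_int a3 * v\<^sup>2 - of_int a6 * v ^ 3 = fps_X ^ 3"
    using v unfolding is_w_expansion_def by (simp add: algebra_simps)
  finally have "(w - v) * c = 0" by simp
  moreover have "fps_nth c 0 = 1"
    using w v by (simp add: c_def is_w_expansion_def power2_eq_square flip: fps_of_int)
  hence "c \<noteq> 0" by auto
  ultimately show "w = v" by simp
qed

lemma is_w_expansion_w_expansion: "is_w_expansion a3 a6 (w_expansion a3 a6)"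
  unfolding w_expansion_def by (rule theI'[OF ex1_w_expansion])

lemma w_expansion_nonzero: "w_expansion a3 a6 \<noteq> 0"
  using is_w_expansion_w_expansion[of a3 a6] by (auto simp: is_w_expansion_def)

lemma xy_expansion_on_curve:
  "(y_expansion a3 a6)\<^sup>2 + of_int a3 * y_expansion a3 a6 = x_expansion a3 a6 ^ 3 + of_int a6"
proof -
  define W where "W = fps_to_fls (w_expansion a3 a6)"
  have "W \<noteq> 0" using w_expansion_nonzero by (simp add: W_def)
  have "w_expansion a3 a6 =
      fps_X ^ 3 + of_int a3 * (w_expansion a3 a6)\<^sup>2 + of_int a6 * w_expansion a3 a6 ^ 3"
    using is_w_expansion_w_expansion[of a3 a6] by (simp add: is_w_expansion_def)
  from arg_cong[OF this, of fps_to_fls]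
  have "W = fls_X ^ 3 + of_int a3 * W\<^sup>2 + of_int a6 * W ^ 3"
    by (simp add: W_def fps_to_fls_power fls_times_fps_to_fls)
  hence eq: "fls_X ^ 3 = W - of_int a3 * W\<^sup>2 - of_int a6 * W ^ 3"
    by (simp add: algebra_simps)
  show ?thesis
    using \<open>W \<noteq> 0\<close> unfolding x_expansion_def y_expansion_def W_def[symmetric] power_divide eq
    by (simp add: field_simps power2_eq_square power3_eq_cube)
qed

lemma invariant_differential_alt:
  "invariant_differential a3 a6 = fls_deriv (y_expansion a3 a6) / (3 * (x_expansion a3 a6)\<^sup>2)"
proof -
  define W where "W = fps_to_fls (w_expansion a3 a6)"
  define x where "x = x_expansion a3 a6"
  define y where "y = y_expansion a3 a6"
  have W: "W \<noteq> 0" using w_expansion_nonzero by (simp add: W_def)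
  have x0: "x \<noteq> 0" using W by (simp add: x_def x_expansion_def W_def)
  have den: "2 * y + of_int a3 \<noteq> 0"
  proof
    assume "2 * y + of_int a3 = 0"
    hence "W * (2 * y + of_int a3) = 0" by simp
    hence "of_int a3 * W = 2"
      using W by (simp add: y_def y_expansion_def algebra_simps flip: W_def)
    hence "fls_nth (of_int a3 * W) 0 = fls_nth 2 0" by simp
    moreover have "fls_nth W 0 = 0"
      using is_w_expansion_w_expansion[of a3 a6] by (simp add: W_def is_w_expansion_def)
    ultimately show False by (simp flip: fls_of_int)
  qed
  have "fls_deriv (y\<^sup>2 + of_int a3 * y) = fls_deriv (x ^ 3 + of_int a6)"
    unfolding x_def y_def xy_expansion_on_curve ..
  hence "(2 * y + of_int a3) * fls_deriv y = 3 * x\<^sup>2 * fls_deriv x"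
    by (simp add: power2_eq_square power3_eq_cube algebra_simps)
  thus ?thesis using den x0
    unfolding invariant_differential_def x_def[symmetric] y_def[symmetric]
    by (simp add: field_simps)
qed

lemma singular_point_iff:
  "singular_point a3 a6 x y z \<longleftrightarrow>
     weierstrass_form a3 a6 x y z = 0 \<and> - 3 * x\<^sup>2 = 0 \<and> 2 * y * z + of_int a3 * z\<^sup>2 = 0 \<and>
     y\<^sup>2 + 2 * of_int a3 * y * z - 3 * of_int a6 * z\<^sup>2 = 0"
  unfolding singular_point_def weierstrass_form_def
  by (simp add: pderiv_diff pderiv_add pderiv_mult pderiv_pCons power2_eq_square power3_eq_cube
      algebra_simps of_int_poly)

lemma is_elliptic_curve_iff: "is_elliptic_curve a3 a6 \<longleftrightarrow> a3\<^sup>2 + 4 * a6 \<noteq> 0"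
proof -
  have D: "(of_int a3)\<^sup>2 + 4 * of_int a6 = (0 :: rat alg_closure) \<longleftrightarrow> a3\<^sup>2 + 4 * a6 = 0"
  proof -
    have "(of_int a3)\<^sup>2 + 4 * of_int a6 = (of_int (a3\<^sup>2 + 4 * a6) :: rat alg_closure)"
      by simp
    thus ?thesis by (simp only: of_int_eq_0_iff)
  qed
  show ?thesis
  proof
    assume ell: "is_elliptic_curve a3 a6"
    show "a3\<^sup>2 + 4 * a6 \<noteq> 0"
    proof
      assume "a3\<^sup>2 + 4 * a6 = 0"
      with D have "(of_int a3)\<^sup>2 + 4 * of_int a6 = (0 :: rat alg_closure)" by simp
      hence "4 * of_int a6 = - ((of_int a3)\<^sup>2 :: rat alg_closure)"
        by (simp only: add_eq_0_iff)
      hence a6: "of_int a6 = - ((of_int a3)\<^sup>2 / 4 :: rat alg_closure)"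
        by (metis minus_divide_left nonzero_mult_div_cancel_left zero_neq_numeral)
      have "singular_point a3 a6 0 (- of_int a3 / 2) (1 :: rat alg_closure)"
        unfolding singular_point_iff weierstrass_form_def a6
        by (simp add: field_simps power2_eq_square)
      with ell show False by (auto simp: is_elliptic_curve_def)
    qed
  next
    assume nz: "a3\<^sup>2 + 4 * a6 \<noteq> 0"
    show "is_elliptic_curve a3 a6"
      unfolding is_elliptic_curve_def
    proof (intro allI impI notI)
      fix x y z :: "rat alg_closure"
      assume xyz: "(x, y, z) \<noteq> (0, 0, 0)" and "singular_point a3 a6 x y z"
      hence F: "weierstrass_form a3 a6 x y z = 0" and Fx: "- 3 * x\<^sup>2 = 0"
        and Fy: "2 * y * z + of_int a3 * z\<^sup>2 = 0"
        and Fz: "y\<^sup>2 + 2 * of_int a3 * y * z - 3 * of_int a6 * z\<^sup>2 = 0"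
        unfolding singular_point_iff by blast+
      have x: "x = 0" using Fx by simp
      have z: "z \<noteq> 0" using xyz x Fz by auto
      have "z * (2 * y + of_int a3 * z) = 0"
        using Fy by (simp add: algebra_simps power2_eq_square)
      with z have "2 * y = - of_int a3 * z"
        by (simp add: eq_neg_iff_add_eq_0)
      hence y: "y = - of_int a3 * z / 2"
        by (metis nonzero_mult_div_cancel_left zero_neq_numeral)
      have "z ^ 3 * ((of_int a3)\<^sup>2 + 4 * of_int a6) = - 4 * weierstrass_form a3 a6 x y z"
        unfolding weierstrass_form_def x y
        by (simp add: field_simps power2_eq_square power3_eq_cube)
      hence "(of_int a3)\<^sup>2 + 4 * of_int a6 = (0 :: rat alg_closure)" using F z by simp
      with D nz show False by simp
    qed
  qed
qed

end

theory Submission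
  imports Defs
begin

text \<open>Let \<open>V\<close> be the compositional inverse of \<open>G(u) = u - a\<^sub>3 u\<^sup>2 - a\<^sub>6 u\<^sup>3\<close>. The equation for \<open>w\<close> says
  \<open>G(w(z)) = z\<^sup>3\<close>, so \<open>w(z) = V(z\<^sup>3)\<close>, and \<open>dy / (3 x\<^sup>2) = w'(z) / (3 z\<^sup>2) dz = V'(z\<^sup>3) dz\<close>. By Lagrange
  inversion, the coefficient of \<open>t\<^sup>N\<close> in \<open>V'(t)\<close> is that of \<open>u\<^sup>N\<close> in
  \<open>(1 - a\<^sub>3 u - a\<^sub>6 u\<^sup>2)\<^sup>-\<^sup>N\<^sup>-\<^sup>1\<close>, which the binomial theorem evaluates.\<close>

section \<open>Formal residues and Lagrange inversion\<close>

text \<open>Up to the nonzero factor \<open>- (n + 1)\<close> the series is the derivative of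
  \<open>inverse (g ^ Suc n)\<close>, and a derivative has no residue.\<close>

lemma fls_residue_deriv_divide_power:
  fixes g :: "'a::field_char_0 fls"
  assumes "g \<noteq> 0"
  shows "fls_residue (fls_deriv g / g ^ Suc (Suc n)) = 0"
proof -
  have "fls_deriv (inverse (g ^ Suc n)) = - of_nat (Suc n) * (fls_deriv g / g ^ Suc (Suc n))"
    unfolding fls_inverse_deriv fls_deriv_power using assms
    by (simp add: field_simps power2_eq_square del: of_nat_Suc)
  hence "of_nat (Suc n) * fls_residue (fls_deriv g / g ^ Suc (Suc n)) = 0"
    using fls_residue_deriv[of "inverse (g ^ Suc n)"]
      fls_residue_of_int_times(1)[of "- int (Suc n)" "fls_deriv g / g ^ Suc (Suc n)"]
    by (simp del: of_nat_Suc fls_residue_def power_Suc)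
  thus ?thesis by (simp del: of_nat_Suc)
qed

text \<open>This is the change of variables \<open>t = G(z)\<close> in the residue of
  \<open>F(t) / t ^ Suc n dt\<close>. Peeling off the coefficients of \<open>F\<close> one by one
  leaves only that of \<open>g' / g\<close>, whose residue is the order of vanishing of
  \<open>G\<close>.\<close>

lemma fls_residue_substitution:
  fixes F G :: "'a::field_char_0 fps"
  assumes G0: "fps_nth G 0 = 0" and G: "G \<noteq> 0"
  shows "fls_residue (fps_to_fls ((F oo G) * fps_deriv G) / fps_to_fls G ^ Suc n) =
           of_nat (subdegree G) * fps_nth F n"
proof -
  define g where "g = fps_to_fls G"
  have g: "g \<noteq> 0" using G by (simp add: g_def)
  have step: "fls_residue (fps_to_fls ((F oo G) * fps_deriv G) / g ^ Suc n) =
      fps_nth F 0 * fls_residue (fls_deriv g / g ^ Suc n) +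
      fls_residue (fps_to_fls ((fps_shift 1 F oo G) * fps_deriv G) / g ^ n)" for F n
  proof -
    have "F = fps_const (fps_nth F 0) + fps_shift 1 F * fps_X"
      by (rule fps_ext) simp
    hence "F oo G = (fps_const (fps_nth F 0) + fps_shift 1 F * fps_X) oo G" by simp
    also have "\<dots> = fps_const (fps_nth F 0) + (fps_shift 1 F oo G) * G"
      using G0 by (simp add: fps_compose_add_distrib fps_compose_mult_distrib)
    finally have "fps_to_fls ((F oo G) * fps_deriv G) / g ^ Suc n =
        fls_const (fps_nth F 0) * (fls_deriv g / g ^ Suc n) +
        fps_to_fls ((fps_shift 1 F oo G) * fps_deriv G) / g ^ n"
      using g by (simp add: fls_times_fps_to_fls fls_deriv_fps_to_fls g_def field_simps)
    thus ?thesis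
      by (simp only: fls_residue_add fls_residue_fls_const_times)
  qed
  show ?thesis
    unfolding g_def[symmetric]
  proof (induction n arbitrary: F)
    \<comment> \<open>The remainder in \<open>step\<close> is now a power series, so it has no
      residue.\<close>
    case 0
    have "fls_residue (fls_deriv g / g ^ Suc 0) = of_nat (subdegree G)"
      using fls_residue_deriv_times_inverse_eq_subdegree(1)[of g]
      by (simp add: divide_inverse g_def fls_subdegree_fls_to_fps)
    thus ?case unfolding step by simp
  next
    case (Suc n)
    show ?case
      unfolding step[of F "Suc n"] Suc.IH fls_residue_deriv_divide_power[OF g] by simp
  qed
qed

text \<open>Lagrange inversion: for \<open>F\<close> the derivative of the inverse series,
  \<open>F(G) G' = 1\<close>, so the substitution rule turns the coefficient into the residue of
  \<open>1 / G ^ Suc n\<close>.\<close>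

lemma fps_deriv_fps_inv_nth:
  fixes P :: "'a::field_char_0 fps"
  assumes P: "fps_nth P 0 \<noteq> 0"
  shows "fps_nth (fps_deriv (fps_inv (fps_X * P))) n = fps_nth (inverse (P ^ Suc n)) n"
proof -
  define G where "G = fps_X * P"
  have G: "fps_nth G 0 = 0" "fps_nth G 1 \<noteq> 0"
    using P by (simp_all add: G_def)
  hence "G \<noteq> 0" by auto
  have "subdegree G = 1"
    using G by (intro subdegreeI) auto
  have "(fps_deriv (fps_inv G) oo G) * fps_deriv G = 1"
    using fps_compose_deriv[OF G(1), of "fps_inv G"] fps_inv[OF G] by simp
  hence "fps_nth (fps_deriv (fps_inv G)) n = fls_residue (1 / fps_to_fls G ^ Suc n)"
    using fls_residue_substitution[OF G(1) \<open>G \<noteq> 0\<close>, of "fps_deriv (fps_inv G)" n]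
      \<open>subdegree G = 1\<close> by simp
  also have "1 / fps_to_fls G ^ Suc n = fps_to_fls (inverse (P ^ Suc n)) / fls_X ^ Suc n"
  proof -
    have "inverse (P ^ Suc n) * P ^ Suc n = 1"
      using P by (intro inverse_mult_eq_1) simp
    from arg_cong[OF this, of fps_to_fls]
    have "fps_to_fls (inverse (P ^ Suc n)) * fps_to_fls P ^ Suc n = 1"
      by (simp only: fls_times_fps_to_fls fps_to_fls_power fps_one_to_fls)
    moreover have "fps_to_fls P \<noteq> 0" using P by auto
    ultimately have "fps_to_fls (inverse (P ^ Suc n)) = inverse (fps_to_fls P ^ Suc n)"
      by (metis inverse_unique mult.commute)
    thus ?thesis
      by (simp only: G_def fls_times_fps_to_fls fps_X_to_fls power_mult_distrib divide_inverse
          inverse_mult_distrib mult_1_left mult.commute)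
  qed
  also have "fls_residue \<dots> = fps_nth (inverse (P ^ Suc n)) n"
    by (simp del: power_Suc)
  finally show ?thesis by (simp add: G_def)
qed

section \<open>Coefficients of negative powers of a quadratic\<close>

lemma fps_linear_power_nth:
  fixes a b :: "'a::comm_ring_1"
  shows "fps_nth ((fps_const a + fps_const b * fps_X) ^ k) j =
           of_nat (k choose j) * a ^ (k - j) * b ^ j"
proof -
  have "(fps_const b * fps_X + fps_const a) ^ k =
      (\<Sum>i\<le>k. fps_const (of_nat (k choose i) * b ^ i * a ^ (k - i)) * fps_X ^ i)"
    unfolding binomial_ring
    by (intro sum.cong refl)
       (simp only: power_mult_distrib fps_const_power fps_of_nat[symmetric]
          fps_const_mult[symmetric] mult_ac)
  hence "fps_nth ((fps_const b * fps_X + fps_const a) ^ k) j =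
      (\<Sum>i\<le>k. if i = j then of_nat (k choose i) * b ^ i * a ^ (k - i) else 0)"
    by (simp add: fps_sum_nth fps_X_power_nth if_distrib cong: if_cong)
  thus ?thesis by (simp add: add.commute mult_ac binomial_eq_0)
qed

text \<open>The quadratic is \<open>1 - X L\<close> with \<open>L = a + b X\<close>. Expanding
  \<open>(1 - t) ^ -(n + 1)\<close> at \<open>t = X L\<close>, the \<open>k\<close>-th term
  contributes the coefficient of \<open>X ^ (n - k)\<close> in \<open>L ^ k\<close>.\<close>

lemma inverse_quadratic_power_nth:
  fixes a b :: "'a::field_char_0"
  shows "fps_nth (inverse ((1 - fps_const a * fps_X - fps_const b * fps_X\<^sup>2) ^ Suc n)) n =
    (\<Sum>k = n div 2..n. of_nat ((n + k) choose k) * of_nat (k choose (n - k)) *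
       a ^ (2 * k - n) * b ^ (n - k))"
proof -
  define L where "L = fps_const a + fps_const b * fps_X"
  have "inverse ((1 - fps_const a * fps_X - fps_const b * fps_X\<^sup>2) ^ Suc n) =
      inverse ((1 - fps_const 1 * fps_X) ^ Suc n) oo (fps_X * L)"
    by (simp add: fps_inverse_compose fps_compose_power fps_compose_sub_distrib L_def
        power2_eq_square algebra_simps del: power_Suc flip: fps_compose_power)
  also have "fps_nth \<dots> n =
      (\<Sum>k = 0..n. of_nat ((n + k) choose k) * fps_nth (fps_X ^ k * L ^ k) n)"
    by (subst one_minus_const_fps_X_neg_power')
       (simp_all add: fps_compose_nth power_mult_distrib)
  also have "\<dots> = (\<Sum>k = 0..n. of_nat ((n + k) choose k) * of_nat (k choose (n - k)) *
       a ^ (2 * k - n) * b ^ (n - k))"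
    by (intro sum.cong) (auto simp: fps_X_power_mult_nth L_def fps_linear_power_nth mult_2)
  \<comment> \<open>For \<open>k < n div 2\<close> we have \<open>n - k > k\<close>, so the second
    binomial vanishes.\<close>
  also have "\<dots> = (\<Sum>k = n div 2..n. of_nat ((n + k) choose k) * of_nat (k choose (n - k)) *
       a ^ (2 * k - n) * b ^ (n - k))"
    by (intro sum.mono_neutral_right) (auto simp: binomial_eq_0)
  finally show ?thesis .
qed

section \<open>The expansions of \<open>w\<close> and of the differential\<close>

lemma w_expansion_eq:
  fixes a3 a6 :: int
  defines "G \<equiv> fps_X * (1 - fps_const (of_int a3) * fps_X - fps_const (of_int a6) * fps_X\<^sup>2)"
  shows "w_expansion a3 a6 = fps_inv G oo fps_X ^ 3"
proof -
  define w where "w = w_expansion a3 a6"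
  have w: "is_w_expansion a3 a6 w"
    unfolding w_def by (rule is_w_expansion_w_expansion)
  hence w0: "fps_nth w 0 = 0" by (simp add: is_w_expansion_def)
  have G: "fps_nth G 0 = 0" "fps_nth G 1 \<noteq> 0"
    by (simp_all add: G_def)
  have "G = fps_X - fps_const (of_int a3) * fps_X\<^sup>2 - fps_const (of_int a6) * fps_X ^ 3"
    by (simp add: G_def algebra_simps power2_eq_square power3_eq_cube)
  hence "G oo w = w - of_int a3 * w\<^sup>2 - of_int a6 * w ^ 3"
    using w0 by (simp add: fps_compose_sub_distrib fps_compose_mult_distrib
        fps_compose_power[symmetric] flip: fps_of_int)
  also have "\<dots> = fps_X ^ 3"
    using w unfolding is_w_expansion_def by (simp add: algebra_simps)
  finally have "fps_inv G oo fps_X ^ 3 = fps_inv G oo (G oo w)" by simp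
  also have "\<dots> = (fps_inv G oo G) oo w"
    by (rule fps_compose_assoc[OF w0 G(1)])
  also have "\<dots> = w"
    by (simp add: fps_inv[OF G] w0)
  finally show ?thesis by (simp add: w_def)
qed

lemma invariant_differential_eq:
  fixes a3 a6 :: int
  defines "G \<equiv> fps_X * (1 - fps_const (of_int a3) * fps_X - fps_const (of_int a6) * fps_X\<^sup>2)"
  shows "invariant_differential a3 a6 = fps_to_fls (fps_deriv (fps_inv G) oo fps_X ^ 3)"
proof -
  define W where "W = fps_to_fls (w_expansion a3 a6)"
  have W: "W \<noteq> 0" using w_expansion_nonzero by (simp add: W_def)
  have "fls_deriv W = fps_to_fls (fps_deriv (fps_inv G) oo fps_X ^ 3) * (3 * fls_X\<^sup>2)"
    unfolding W_def w_expansion_eq G_def[symmetric] fls_deriv_fps_to_fls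
    by (simp add: fps_compose_deriv fps_deriv_power fls_times_fps_to_fls fps_to_fls_power)
  \<comment> \<open>The form \<open>dy / (3 x\<^sup>2)\<close> is convenient because the
    \<open>W\<^sup>2\<close> from \<open>dy\<close> cancels against the one in
    \<open>x\<^sup>2\<close>.\<close>
  moreover have "fls_deriv (- 1 / W) = fls_deriv W / W\<^sup>2"
    using fls_inverse_deriv[of W] by (simp add: divide_inverse power_inverse)
  hence "invariant_differential a3 a6 = fls_deriv W / W\<^sup>2 / (3 * (fls_X / W)\<^sup>2)"
    unfolding invariant_differential_alt x_expansion_def y_expansion_def W_def[symmetric] by simp
  hence "invariant_differential a3 a6 = fls_deriv W / (3 * fls_X\<^sup>2)"
    using W unfolding power_divide by simp
  moreover have "3 * fls_X\<^sup>2 \<noteq> (0 :: rat fls)" by simp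
  ultimately show ?thesis by (metis nonzero_divide_eq_eq)
qed

section \<open>Convergence of the series\<close>

text \<open>Agreement in all degrees below \<open>n\<close>, negative ones included, makes the
  distance at most \<open>inverse (2 ^ n)\<close>.\<close>

lemma fls_tendstoI:
  fixes S :: "nat \<Rightarrow> 'a::group_add fls"
  assumes "\<And>n k. k < int n \<Longrightarrow> fls_nth (S n) k = fls_nth L k"
  shows "S \<longlonglongrightarrow> L"
proof (rule metric_LIMSEQ_I)
  fix r :: real assume "r > 0"
  then obtain N where N: "inverse (2 ^ N) < r"
    using real_arch_pow_inv[of r "1/2"] by (auto simp: power_one_over inverse_eq_divide)
  have "dist (S n) L < r" if "n \<ge> N" for n
  proof (cases "S n = L")
    case False
    hence "int n \<le> fls_subdegree (S n - L)"
      using assms by (intro fls_subdegree_geI) auto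
    hence "dist (S n) L \<le> inverse (2 ^ N)"
      using False that by (auto simp: dist_fls_def intro!: power_increasing)
    with N show ?thesis by simp
  qed (use \<open>r > 0\<close> in simp)
  thus "\<exists>N. \<forall>n\<ge>N. dist (S n) L < r" by blast
qed

lemma fls_sums_compose_X_power:
  fixes F :: "'a::comm_ring_1 fps"
  assumes "d > 0"
  shows "(\<lambda>m. fls_const (fps_nth F m) * fls_X ^ (d * m)) sums fps_to_fls (F oo fps_X ^ d)"
  unfolding sums_def
proof (rule fls_tendstoI)
  fix n :: nat and k :: int assume k: "k < int n"
  show "fls_nth (\<Sum>m<n. fls_const (fps_nth F m) * fls_X ^ (d * m)) k =
      fls_nth (fps_to_fls (F oo fps_X ^ d)) k"
  proof (cases "k \<ge> 0")
    case True
    then obtain j where j: "k = int j" using nonneg_int_cases by blast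
    have "fls_nth (\<Sum>m<n. fls_const (fps_nth F m) * fls_X ^ (d * m)) k =
        (\<Sum>m<n. if j = d * m then fps_nth F m else 0)"
      by (intro trans[OF fls_nth_sum] sum.cong) (auto simp: j simp flip: of_nat_mult)
    \<comment> \<open>The only candidate index \<open>j div d\<close> lies in the partial sum, as
      \<open>j div d \<le> j < n\<close>.\<close>
    also have "\<dots> = (\<Sum>m\<in>(if d dvd j then {j div d} else {}). fps_nth F m)"
      using k assms j le_less_trans[OF div_le_dividend[of j d], of n]
      by (intro sum.mono_neutral_cong_right) (auto split: if_splits)
    also have "\<dots> = fls_nth (fps_to_fls (F oo fps_X ^ d)) k"
      by (simp add: j fps_nth_compose_X_power)
    finally show ?thesis .
  next
    case False
    hence "k \<noteq> int (d * m)" for m by linarith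
    thus ?thesis using False by (simp add: fls_nth_sum del: of_nat_mult)
  qed
qed

theorem theorem4:
  fixes a3 a6 :: int
  assumes "is_elliptic_curve a3 a6"
  shows "(\<lambda>m. let n = m + 1 in
            of_int (\<Sum>k = (n - 1) div 2..n - 1.
              int ((n + k - 1) choose k) * int (k choose (n - k - 1)) *
              a3 ^ (2 * k + 1 - n) * a6 ^ (n - k - 1)) *
            fls_X ^ (3 * n - 3))
         sums invariant_differential a3 a6"
proof -
  define P :: "rat fps"
    where "P = 1 - fps_const (of_int a3) * fps_X - fps_const (of_int a6) * fps_X\<^sup>2"
  have "fps_nth P 0 \<noteq> 0" by (simp add: P_def)
  hence "fps_nth (fps_deriv (fps_inv (fps_X * P))) m =
      of_int (\<Sum>k = m div 2..m. int ((m + k) choose k) * int (k choose (m - k)) *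
        a3 ^ (2 * k - m) * a6 ^ (m - k))" for m
    by (simp add: fps_deriv_fps_inv_nth P_def inverse_quadratic_power_nth
        del: power_Suc fps_deriv_nth)
  hence "(\<lambda>m. of_int (\<Sum>k = m div 2..m. int ((m + k) choose k) * int (k choose (m - k)) *
        a3 ^ (2 * k - m) * a6 ^ (m - k)) * fls_X ^ (3 * m)) sums
      fps_to_fls (fps_deriv (fps_inv (fps_X * P)) oo fps_X ^ 3)"
    using fls_sums_compose_X_power[of 3 "fps_deriv (fps_inv (fps_X * P))"]
    by (simp only: fls_of_int zero_less_numeral simp_thms)
  also have "fps_to_fls (fps_deriv (fps_inv (fps_X * P)) oo fps_X ^ 3) =
      invariant_differential a3 a6"
    unfolding invariant_differential_eq P_def ..
  \<comment> \<open>With \<open>n = m + 1\<close> the exponents agree, also under truncated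
    subtraction. For odd \<open>m\<close> and \<open>k = m div 2\<close> the true exponent of
    \<open>a3\<close> is -1 and is truncated to 0, but \<open>k choose (m - k)\<close> is 0
    there.\<close>
  finally show ?thesis
    by (simp add: Let_def del: of_int_sum)
qed

end
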